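(* Let $n\geq 2$ be an integer. Then $\mu(W(B_n)) = 2n$.
   Context: For a finite group $G$, $\mu(G)$ denotes the minimal faithful permutation degree of $G$: the least non-negative integer $m$ such that $G$ embeds in the symmetric group $\mathrm{Sym}(m)$. $W(B_n)$ denotes the Coxeter group of type $B_n$, i.e. the full wreath product $C_2\wr \mathrm{Sym}(n)$, which is the group of all signed permutations of $\{\pm 1,\dots,\pm n\}$. *)

theory Defs
  imports "HOL-Algebra.Algebra"
begin

(* For finite G the set of such m is nonempty by Cayley's theorem, so LEAST is well behaved. *)
definition min_faithful_degree :: "('a, 'b) monoid_scheme \<Rightarrow> nat" where
  "min_faithful_degree G = (LEAST m. mon G (sym_group m) \<noteq> {})"

(* The wreath product of A with Sym(n) in its natural action on {1..n}. Permutations compose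
   from right to left, so s acts on the base group by g |-> g o s^{-1}. *)
definition wreath_sym ::
    "('a, 'b) monoid_scheme \<Rightarrow> nat \<Rightarrow> ((nat \<Rightarrow> 'a) \<times> (nat \<Rightarrow> nat)) monoid" where
  "wreath_sym A n =
    \<lparr> carrier = ({1..n} \<rightarrow>\<^sub>E carrier A) \<times> carrier (sym_group n),
      monoid.mult = (\<lambda>(f, s) (g, t). (\<lambda>i\<in>{1..n}. f i \<otimes>\<^bsub>A\<^esub> g (inv' s i), s \<circ> t)),
      one = (\<lambda>i\<in>{1..n}. \<one>\<^bsub>A\<^esub>, id) \<rparr>"

(* W(B_n) = C_2 wr Sym(n); it is isomorphic to the group of signed permutations of
   {-n..n} - {0}, as shown in coxeter_B_iso_signed_perm_group. *)
definition coxeter_B :: "nat \<Rightarrow> ((nat \<Rightarrow> int) \<times> (nat \<Rightarrow> nat)) monoid" where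
  "coxeter_B n = wreath_sym (integer_mod_group 2) n"

definition signed_perm_group :: "nat \<Rightarrow> (int \<Rightarrow> int) monoid" where
  "signed_perm_group n =
    \<lparr> carrier = {p. p permutes ({- int n..int n} - {0}) \<and> (\<forall>k. p (- k) = - p k)},
      monoid.mult = (\<circ>), one = id \<rparr>"

lemma group_wreath_sym:
  assumes "group A"
  shows "group (wreath_sym A n)"
proof -
  interpret A: group A by fact
  have inv_in: "inv' s i \<in> {1..n}" if "s permutes {1..n}" "i \<in> {1..n}" for s i
    using permutes_in_image[OF permutes_inv[OF that(1)]] that(2) by blast
  have in_A: "f i \<in> carrier A" if "f \<in> {1..n} \<rightarrow>\<^sub>E carrier A" "i \<in> {1..n}" for f i
    using that by (rule PiE_mem)
  have inv_comp: "inv' (s \<circ> t) = inv' t \<circ> inv' s" if "s permutes {1..n}" "t permutes {1..n}" for s t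
    using that by (simp add: o_inv_distrib permutes_bij)
  show ?thesis
  proof (rule groupI, goal_cases)
    case (1 x y)
    obtain f s g t where xy: "x = (f, s)" "y = (g, t)" by (cases x, cases y)
    have p: "s permutes {1..n}" "t permutes {1..n}"
      and f: "f \<in> {1..n} \<rightarrow>\<^sub>E carrier A" "g \<in> {1..n} \<rightarrow>\<^sub>E carrier A"
      using 1 by (auto simp: xy wreath_sym_def sym_group_def)
    have "f i \<otimes>\<^bsub>A\<^esub> g (inv' s i) \<in> carrier A" if "i \<in> {1..n}" for i
      using that by (intro A.m_closed in_A[OF f(1)] in_A[OF f(2)] inv_in[OF p(1)])
    then show ?case
      using permutes_compose[OF p(2) p(1)] by (simp add: xy wreath_sym_def sym_group_def)
  next
    case 2
    then show ?case by (auto simp: wreath_sym_def sym_group_def permutes_id)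
  next
    case (3 x y z)
    obtain f s g t h u where xyz: "x = (f, s)" "y = (g, t)" "z = (h, u)"
      by (cases x, cases y, cases z)
    have p: "s permutes {1..n}" "t permutes {1..n}" "u permutes {1..n}"
      and f: "f \<in> {1..n} \<rightarrow>\<^sub>E carrier A" "g \<in> {1..n} \<rightarrow>\<^sub>E carrier A" "h \<in> {1..n} \<rightarrow>\<^sub>E carrier A"
      using 3 by (auto simp: xyz wreath_sym_def sym_group_def)
    have "f i \<otimes>\<^bsub>A\<^esub> g (inv' s i) \<otimes>\<^bsub>A\<^esub> h (inv' (s \<circ> t) i)
        = f i \<otimes>\<^bsub>A\<^esub> (g (inv' s i) \<otimes>\<^bsub>A\<^esub> h (inv' t (inv' s i)))" if "i \<in> {1..n}" for i
      using that by (simp add: inv_comp p A.m_assoc in_A f inv_in del: atLeastAtMost_iff One_nat_def)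
    then show ?case
      using inv_in[OF p(1)]
      by (auto simp: xyz wreath_sym_def comp_assoc restrict_def fun_eq_iff simp del: One_nat_def)
  next
    case (4 x)
    obtain f s where x: "x = (f, s)" by (cases x)
    have "s permutes {1..n}" and f: "f \<in> {1..n} \<rightarrow>\<^sub>E carrier A"
      using 4 by (auto simp: x wreath_sym_def sym_group_def)
    have "f i = undefined" if "i \<notin> {1..n}" for i
      using f that by (rule PiE_arb)
    then show ?case
      using in_A[OF f] by (auto simp: wreath_sym_def x restrict_def fun_eq_iff)
  next
    case (5 x)
    obtain f s where x: "x = (f, s)" by (cases x)
    have s: "s permutes {1..n}" and f: "f \<in> {1..n} \<rightarrow>\<^sub>E carrier A"
      using 5 by (auto simp: x wreath_sym_def sym_group_def)
    have inv_inv: "inv' (inv' s) = s"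
      using s by (simp add: inv_inv_eq permutes_bij)
    have s_in: "s i \<in> {1..n}" if "i \<in> {1..n}" for i
      using permutes_in_image[OF s] that by blast
    define y where "y = ((\<lambda>i\<in>{1..n}. inv\<^bsub>A\<^esub> f (s i)), inv' s)"
    have "y \<in> carrier (wreath_sym A n)"
      unfolding y_def wreath_sym_def using in_A[OF f s_in] permutes_inv[OF s]
      by (auto simp: sym_group_def simp del: One_nat_def)
    moreover have "y \<otimes>\<^bsub>wreath_sym A n\<^esub> x = \<one>\<^bsub>wreath_sym A n\<^esub>"
      using in_A[OF f s_in] permutes_inv_o(2)[OF s]
      by (auto simp: y_def x wreath_sym_def inv_inv restrict_def fun_eq_iff simp del: One_nat_def)
    ultimately show ?case by blast
  qed
qed

lemma coxeter_B_iso_signed_perm_group: "coxeter_B n \<cong> signed_perm_group n"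
proof -
  define e :: "int \<Rightarrow> int" where "e a = (if a = 0 then 1 else - 1)" for a
  define P :: "(nat \<Rightarrow> int) \<times> (nat \<Rightarrow> nat) \<Rightarrow> int \<Rightarrow> int" where
    "P = (\<lambda>(f, s) k. if \<bar>k\<bar> \<in> {1..int n}
            then sgn k * e (f (s (nat \<bar>k\<bar>))) * int (s (nat \<bar>k\<bar>)) else k)"
  define D where "D = {- int n..int n} - {0}"
  have D_iff: "k \<in> D \<longleftrightarrow> \<bar>k\<bar> \<in> {1..int n}" for k
    by (auto simp: D_def)
  have abs_e: "\<bar>e a\<bar> = 1" for a
    by (simp add: e_def)
  have car: "carrier (coxeter_B n) = ({1..n} \<rightarrow>\<^sub>E {0, 1}) \<times> {s. s permutes {1..n}}"
  proof -
    have "{0..<2::int} = {0, 1}" by auto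
    then show ?thesis
      by (simp add: coxeter_B_def wreath_sym_def sym_group_def carrier_integer_mod_group)
  qed
  have s_in: "s i \<in> {1..n}" if "s permutes {1..n}" "i \<in> {1..n}" for s i
    using permutes_in_image[OF that(1)] that(2) by blast
  have nat_in: "nat \<bar>k\<bar> \<in> {1..n}" if "k \<in> D" for k
    using that by (auto simp: D_iff)
  have abs_P: "\<bar>P (f, s) k\<bar> = int (s (nat \<bar>k\<bar>))" if "s permutes {1..n}" "k \<in> D" for f s k
    using that by (auto simp: P_def D_iff abs_mult abs_e abs_sgn_eq)
  have sgn_P: "sgn (P (f, s) k) = sgn k * e (f (s (nat \<bar>k\<bar>)))" if "s permutes {1..n}" "k \<in> D" for f s k
  proof -
    have "s (nat \<bar>k\<bar>) \<ge> 1" using s_in[OF that(1) nat_in[OF that(2)]] by simp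
    then show ?thesis using that(2) by (auto simp: P_def D_iff e_def sgn_mult)
  qed
  have P_D: "P (f, s) k \<in> D" if "s permutes {1..n}" "k \<in> D" for f s k
    using s_in[OF that(1) nat_in[OF that(2)]] unfolding D_iff abs_P[OF that] by simp
  have P_out: "P x k = k" if "k \<notin> D" for x k
    using that by (auto simp: P_def D_iff split: prod.splits)
  have P_minus: "P x (- k) = - P x k" for x k
    by (auto simp: P_def sgn_minus split: prod.splits)
  have int_eqI: "a = b" if "\<bar>a\<bar> = \<bar>b\<bar>" "sgn a = sgn b" for a b :: int
    using that by (metis mult_sgn_abs)
  have P_inj: "inj_on (P (f, s)) D" if "s permutes {1..n}" for f s
  proof (rule inj_onI)
    fix k l assume kl: "k \<in> D" "l \<in> D" "P (f, s) k = P (f, s) l"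
    have "s (nat \<bar>k\<bar>) = s (nat \<bar>l\<bar>)"
      using abs_P[OF that kl(1), of f] abs_P[OF that kl(2), of f] kl(3) by simp
    moreover from this have "nat \<bar>k\<bar> = nat \<bar>l\<bar>"
      using permutes_inj[OF that] by (simp add: inj_eq)
    moreover have "e (f (s (nat \<bar>l\<bar>))) \<noteq> 0"
      by (simp add: e_def)
    ultimately have "sgn k = sgn l" "\<bar>k\<bar> = \<bar>l\<bar>"
      using sgn_P[OF that kl(1), of f] sgn_P[OF that kl(2), of f] kl(3) by auto
    then show "k = l" by (rule int_eqI[rotated])
  qed
  have P_perm: "P (f, s) permutes D" if "s permutes {1..n}" for f s
  proof -
    have "finite D" by (simp add: D_def)
    moreover have "P (f, s) ` D \<subseteq> D" using P_D[OF that] by blast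
    ultimately have "bij_betw (P (f, s)) D D"
      using P_inj[OF that] by (simp add: bij_betw_def endo_inj_surj)
    then show ?thesis by (rule bij_imp_permutes) (rule P_out)
  qed
  have "P \<in> hom (coxeter_B n) (signed_perm_group n)"
  proof (rule homI)
    fix x assume "x \<in> carrier (coxeter_B n)"
    then show "P x \<in> carrier (signed_perm_group n)"
      using P_perm by (auto simp: car signed_perm_group_def P_minus simp flip: D_def)
  next
    fix x y assume "x \<in> carrier (coxeter_B n)" "y \<in> carrier (coxeter_B n)"
    then obtain f s g t where xy: "x = (f, s)" "y = (g, t)"
      and s: "s permutes {1..n}" and t: "t permutes {1..n}"
      and f: "f \<in> {1..n} \<rightarrow>\<^sub>E {0, 1}" and g: "g \<in> {1..n} \<rightarrow>\<^sub>E {0, 1}"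
      by (auto simp: car)
    have st: "(s \<circ> t) permutes {1..n}"
      using s t by (rule permutes_compose[rotated])
    define h where "h = (\<lambda>i\<in>{1..n}. (f i + g (inv' s i)) mod 2)"
    have xy_mult: "x \<otimes>\<^bsub>coxeter_B n\<^esub> y = (h, s \<circ> t)"
      by (simp add: xy h_def coxeter_B_def wreath_sym_def)
    have "P (h, s \<circ> t) k = P (f, s) (P (g, t) k)" for k
    proof (cases "k \<in> D")
      case True
      let ?i = "t (nat \<bar>k\<bar>)"
      have i: "?i \<in> {1..n}" "s ?i \<in> {1..n}"
        using s_in[OF t nat_in[OF True]] s_in[OF s] by auto
      have fg: "f (s ?i) \<in> {0, 1}" "g ?i \<in> {0, 1}"
        using f g i by (blast dest: PiE_mem)+
      have e: "e (h (s ?i)) = e (f (s ?i)) * e (g ?i)"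
      proof -
        have "h (s ?i) = (f (s ?i) + g ?i) mod 2"
          unfolding h_def restrict_apply'[OF i(2)] permutes_inverses(2)[OF s] ..
        moreover have "e ((a + b) mod 2) = e a * e b" if "a \<in> {0, 1}" "b \<in> {0, 1}" for a b
          using that by (auto simp: e_def)
        ultimately show ?thesis
          by (metis fg)
      qed
      show ?thesis
      proof (rule int_eqI)
        show "\<bar>P (h, s \<circ> t) k\<bar> = \<bar>P (f, s) (P (g, t) k)\<bar>"
          unfolding abs_P[OF st True] abs_P[OF s P_D[OF t True]] abs_P[OF t True] by simp
        show "sgn (P (h, s \<circ> t) k) = sgn (P (f, s) (P (g, t) k))"
          unfolding sgn_P[OF st True] sgn_P[OF s P_D[OF t True]] sgn_P[OF t True] abs_P[OF t True]
          using e by simp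
      qed
    qed (simp add: P_out)
    then show "P (x \<otimes>\<^bsub>coxeter_B n\<^esub> y) = P x \<otimes>\<^bsub>signed_perm_group n\<^esub> P y"
      by (simp add: xy_mult signed_perm_group_def fun_eq_iff) (simp add: xy)
  qed
  moreover have "inj_on P (carrier (coxeter_B n))"
  proof (rule inj_onI)
    fix x y assume "x \<in> carrier (coxeter_B n)" "y \<in> carrier (coxeter_B n)" and eq: "P x = P y"
    then obtain f s g t where xy: "x = (f, s)" "y = (g, t)"
      and s: "s permutes {1..n}" and t: "t permutes {1..n}"
      and f: "f \<in> {1..n} \<rightarrow>\<^sub>E {0, 1}" and g: "g \<in> {1..n} \<rightarrow>\<^sub>E {0, 1}"
      by (auto simp: car)
    have i_D: "int i \<in> D" if "i \<in> {1..n}" for i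
      using that by (auto simp: D_iff)
    have eq': "P (f, s) = P (g, t)" using eq by (simp add: xy)
    have st: "s i = t i" if "i \<in> {1..n}" for i
      using abs_P[OF s i_D[OF that], of f] abs_P[OF t i_D[OF that], of g] eq' by simp
    have "s = t"
    proof
      fix i show "s i = t i"
        using st s t by (cases "i \<in> {1..n}") (auto simp: permutes_not_in)
    qed
    moreover have "f = g"
    proof (rule PiE_ext[OF f g])
      fix i assume i: "i \<in> {1..n}"
      define j where "j = inv' s i"
      have j: "j \<in> {1..n}" "s j = i"
        using i permutes_in_image[OF permutes_inv[OF s], of i] permutes_inverses(1)[OF s]
        by (simp_all add: j_def)
      have "e (f i) = e (g i)"
        using sgn_P[OF s i_D[OF j(1)], of f] sgn_P[OF s i_D[OF j(1)], of g] j eq'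
        by (auto simp flip: \<open>s = t\<close>)
      moreover have "f i \<in> {0, 1}" "g i \<in> {0, 1}"
        using f g i by (blast dest: PiE_mem)+
      ultimately show "f i = g i" by (auto simp: e_def split: if_splits)
    qed
    ultimately show "x = y" by (simp add: xy)
  qed
  moreover have "p \<in> P ` carrier (coxeter_B n)" if "p \<in> carrier (signed_perm_group n)" for p
  proof -
    have p: "p permutes D" and pm: "p (- k) = - p k" for k
      using that by (auto simp: signed_perm_group_def D_def)
    have p_D: "p k \<in> D \<longleftrightarrow> k \<in> D" for k
      by (rule permutes_in_image[OF p])
    define s where "s i = (if i \<in> {1..n} then nat \<bar>p (int i)\<bar> else i)" for i
    have i_D: "int i \<in> D" if "i \<in> {1..n}" for i
      using that by (auto simp: D_iff)
    have "inj_on s {1..n}"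
    proof (rule inj_onI)
      fix i j assume ij: "i \<in> {1..n}" "j \<in> {1..n}" "s i = s j"
      then have "p (int i) = p (int j) \<or> p (int i) = p (- int j)"
        by (auto simp: s_def pm abs_eq_iff nat_eq_iff)
      then have "int i = int j \<or> int i = - int j"
        using permutes_inj[OF p] by (simp add: inj_eq)
      then show "i = j" using ij by auto
    qed
    moreover have "s ` {1..n} \<subseteq> {1..n}"
      using nat_in i_D p_D by (auto simp: s_def)
    ultimately have "bij_betw s {1..n} {1..n}"
      by (simp add: bij_betw_def endo_inj_surj)
    then have s: "s permutes {1..n}"
      by (rule bij_imp_permutes) (simp only: s_def if_False)
    define f where "f = (\<lambda>i\<in>{1..n}. if p (int (inv' s i)) > 0 then 0 else 1 :: int)"
    have fs: "(f, s) \<in> carrier (coxeter_B n)"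
      using s by (auto simp: car f_def)
    have pos: "p (int i) = P (f, s) (int i)" if i: "i \<in> {1..n}" for i
    proof (rule int_eqI)
      have "p (int i) \<noteq> 0" using p_D[of "int i"] i_D[OF i] by (auto simp: D_iff)
      moreover have "f (s i) = (if p (int i) > 0 then 0 else 1)"
        unfolding f_def restrict_apply'[OF s_in[OF s i]] permutes_inverses(2)[OF s] ..
      ultimately show "sgn (p (int i)) = sgn (P (f, s) (int i))"
        using i unfolding sgn_P[OF s i_D[OF i]] by (simp add: e_def sgn_if)
      show "\<bar>p (int i)\<bar> = \<bar>P (f, s) (int i)\<bar>"
        using i by (simp add: abs_P[OF s i_D[OF i]]) (simp add: s_def)
    qed
    have "p k = P (f, s) k" for k
    proof (cases "k \<in> D")
      case True
      have "p (int (nat \<bar>k\<bar>)) = P (f, s) (int (nat \<bar>k\<bar>))"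
        by (rule pos[OF nat_in[OF True]])
      then show ?thesis
        by (cases "k \<ge> 0") (simp_all add: pm P_minus)
    qed (use p in \<open>simp add: P_out permutes_not_in\<close>)
    then show ?thesis using fs by (auto simp: fun_eq_iff image_iff intro!: bexI[of _ "(f, s)"])
  qed
  ultimately have "P \<in> iso (coxeter_B n) (signed_perm_group n)"
    by (auto simp: iso_def bij_betw_def hom_def)
  then show ?thesis by (rule is_isoI)
qed

end

theory Submission
  imports Defs
begin

text \<open>
  Signed permutations of the \<open>2n\<close> points \<open>\<plusminus>1, \<dots>, \<plusminus>n\<close> are in particular permutations of
  these points, which gives an embedding of \<open>W(B\<^sub>n)\<close> into \<open>Sym(2n)\<close>.

  The lower bound needs nothing beyond Lagrange's theorem at the prime \<open>2\<close>. The order of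
  \<open>W(B\<^sub>n)\<close> is \<open>2^n n!\<close>, the product of the even factors \<open>2, 4, \<dots>, 2n\<close> of \<open>(2n)!\<close>; the remaining
  factors are odd, so \<open>W(B\<^sub>n)\<close> has odd index in \<open>Sym(2n)\<close> (it contains a Sylow 2-subgroup).
  If \<open>W(B\<^sub>n)\<close> embedded in \<open>Sym(m)\<close> with \<open>m \<le> 2n - 1\<close>, then \<open>2^n n!\<close> would divide \<open>(2n - 1)!\<close>
  (\<open>order_dvd_fact_of_mon\<close>), and the missing factor \<open>2n\<close> would make the index
  \<open>(2n)! / (2^n n!)\<close> even, contradicting \<open>fact_double_eq\<close>.
\<close>

lemma order_dvd_fact_of_mon:
  assumes "group G" "h \<in> mon G (sym_group m)"
  shows "order G dvd fact m"
proof -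
  have h: "h \<in> hom G (sym_group m)" "inj_on h (carrier G)"
    using assms(2) by (auto simp: mon_def)
  interpret h: group_hom G "sym_group m" h
    using assms(1) sym_group_is_group h(1) by (simp add: group_hom_def group_hom_axioms_def)
  have "card (h ` carrier G) dvd order (sym_group m)"
    using group.lagrange[OF sym_group_is_group h.img_is_subgroup] by (metis dvd_triv_right)
  then show ?thesis
    by (simp add: order_def card_image[OF h(2)] sym_group_card_carrier)
qed

lemma order_wreath_sym: "order (wreath_sym A n) = order A ^ n * fact n"
  by (simp add: order_def wreath_sym_def card_cartesian_product card_PiE sym_group_card_carrier)

lemma order_coxeter_B: "order (coxeter_B n) = 2 ^ n * fact n"
  by (simp add: coxeter_B_def order_wreath_sym) (simp add: order_def carrier_integer_mod_group)

text \<open>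
  The factor \<open>k\<close> is the product \<open>1 \<cdot> 3 \<cdots> (2n - 1)\<close>; what matters is that the even factors
  account for the whole power of \<open>2\<close> in \<open>(2n)!\<close>.
\<close>
lemma fact_double_eq:
  obtains k :: nat where "odd k" "fact (2 * n) = 2 ^ n * fact n * k"
proof -
  have "\<exists>k::nat. odd k \<and> fact (2 * n) = 2 ^ n * fact n * k"
  proof (induction n)
    case (Suc n)
    then obtain k :: nat where k: "odd k" "fact (2 * n) = 2 ^ n * fact n * k" by blast
    have "fact (2 * Suc n) = (2 * Suc n) * (2 * n + 1) * (fact (2 * n) :: nat)"
      by (simp add: algebra_simps)
    also have "\<dots> = 2 ^ Suc n * fact (Suc n) * ((2 * n + 1) * k)"
      unfolding k(2) by (simp add: algebra_simps)
    finally show ?case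
      using k(1) by (intro exI[of _ "(2 * n + 1) * k"]) simp
  qed simp
  then show ?thesis using that by blast
qed

lemma fact_eq_mult_of_less:
  assumes "m < (d::nat)"
  obtains c where "fact d = (d * c * fact m :: nat)"
proof -
  have "fact m dvd (fact (d - 1) :: nat)"
    using assms by (intro fact_dvd) simp
  moreover have "fact d = (d * fact (d - 1) :: nat)"
    using assms fact_reduce[of d, where 'a = nat] by simp
  ultimately show ?thesis
    using that by (metis dvdE mult.assoc mult.commute)
qed

text \<open>
  Forgetting the sign symmetry leaves permutations of \<open>2n\<close> points, and any bijection from these
  points onto \<open>1, \<dots>, 2n\<close> carries them into \<open>Sym(2n)\<close>; carrying them back shows injectivity.
\<close>
lemma signed_perm_group_embeds: "mon (signed_perm_group n) (sym_group (2 * n)) \<noteq> {}"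
proof -
  define D where "D = {- int n..int n} - {0}"
  have "card D = 2 * n"
    by (simp add: D_def)
  then obtain b where b: "bij_betw b D {1..2 * n}"
    by (metis D_def card_atLeastAtMost diff_Suc_1 finite_Diff finite_atLeastAtMost_int
        finite_atLeastAtMost finite_same_card_bij)
  have inj: "inj_on b D"
    using b by (rule bij_betw_imp_inj_on)
  have "map_permutation D b \<in> mon (signed_perm_group n) (sym_group (2 * n))"
  proof (rule mon_left_invertible)
    show "map_permutation D b \<in> hom (signed_perm_group n) (sym_group (2 * n))"
      using map_permutation_permutes[OF b] map_permutation_compose'[OF inj]
      by (intro homI) (auto simp: signed_perm_group_def sym_group_def simp flip: D_def)
    show "map_permutation {1..2 * n} (inv_into D b) (map_permutation D b p) = p"
      if "p \<in> carrier (signed_perm_group n)" for p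
      using that inj
      by (intro map_permutation_compose_inv[OF b])
        (auto simp: signed_perm_group_def simp flip: D_def)
  qed
  then show ?thesis by blast
qed

lemma coxeter_B_embeds: "mon (coxeter_B n) (sym_group (2 * n)) \<noteq> {}"
proof -
  obtain i where "i \<in> iso (coxeter_B n) (signed_perm_group n)"
    using coxeter_B_iso_signed_perm_group by (auto simp: is_iso_def)
  then have "i \<in> mon (coxeter_B n) (signed_perm_group n)"
    by (simp add: iso_iff_mon_epi)
  then show ?thesis
    using signed_perm_group_embeds mon_compose by blast
qed

lemma coxeter_B_embeds_imp_ge:
  assumes "mon (coxeter_B n) (sym_group m) \<noteq> {}"
  shows "2 * n \<le> m"
proof (rule ccontr)
  assume "\<not> 2 * n \<le> m"
  then obtain c where c: "fact (2 * n) = (2 * n * c * fact m :: nat)"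
    by (metis fact_eq_mult_of_less not_le)
  have "group (coxeter_B n)"
    by (simp add: coxeter_B_def group_wreath_sym)
  then have "2 ^ n * fact n dvd (fact m :: nat)"
    using assms order_dvd_fact_of_mon[of "coxeter_B n"] by (auto simp: order_coxeter_B)
  then obtain d where d: "fact m = 2 ^ n * fact n * (d :: nat)" ..
  obtain k :: nat where k: "odd k" "fact (2 * n) = 2 ^ n * fact n * k"
    by (rule fact_double_eq)
  have "2 ^ n * fact n * k = 2 ^ n * fact n * (2 * n * c * d)"
    using c unfolding k(2) d by (simp only: ac_simps)
  then have "k = 2 * n * c * d"
    by simp
  then show False
    using k(1) by simp
qed

theorem mainTheorem2:
  fixes n :: nat
  assumes "n \<ge> 2"
  shows "min_faithful_degree (coxeter_B n) = 2 * n"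
  unfolding min_faithful_degree_def
  using coxeter_B_embeds coxeter_B_embeds_imp_ge by (intro Least_equality)

end
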